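(* $\mathrm{WL}_1\not\preceq\omega^{(2)}$: there exist graphs $G$ and $H$ with $\omega^{(2)}(G)=\omega^{(2)}(H)$ but $\mathrm{WL}_1(G)\ne\mathrm{WL}_1(H)$.
   Context: Graphs are finite, simple and undirected; an $n$-vertex graph has $V(G)=\{1,\dots,n\}$. Let $w_k(x,y)$ be the number of walks of length $k$ from $x$ to $y$ and $w_*(x,y)=(w_0(x,y),\dots,w_{n-1}(x,y))$. Define vertex colorings $\omega_0(x)=w_*(x,x)$ and $\omega_{r+1}(x)=\big(\omega_r(x),\{\!\{(w_*(x,y),\omega_r(y))\}\!\}_{y\in V(G)}\big)$, with $\{\!\{\cdot\}\!\}$ a multiset, and $\omega^{(r)}(G)=\{\!\{\omega_r(x)\}\!\}_{x\in V(G)}$. Color refinement (1-WL): $C^0(x)$ uniform (or the vertex color for colored graphs), $C^{r+1}(x)=\big(C^r(x),\{\!\{C^r(y)\}\!\}_{y\in N(x)}\big)$; $\mathrm{WL}_1(G)=\{\!\{C^n(x)\}\!\}_{x\in V(G)}$. *)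

theory Defs
  imports Main "HOL-Library.Multiset"
begin

definition is_graph :: "nat \<Rightarrow> (nat \<Rightarrow> nat \<Rightarrow> bool) \<Rightarrow> bool" where
  "is_graph n E \<longleftrightarrow> (\<forall>x y. E x y \<longrightarrow> x \<in> {1..n} \<and> y \<in> {1..n} \<and> x \<noteq> y \<and> E y x)"

definition walks :: "nat \<Rightarrow> (nat \<Rightarrow> nat \<Rightarrow> bool) \<Rightarrow> nat \<Rightarrow> nat \<Rightarrow> nat \<Rightarrow> nat list set" where
  "walks n E k x y = {vs. length vs = Suc k \<and> set vs \<subseteq> {1..n} \<and> hd vs = x \<and> last vs = y
      \<and> (\<forall>i<k. E (vs ! i) (vs ! Suc i))}"

definition nwalks :: "nat \<Rightarrow> (nat \<Rightarrow> nat \<Rightarrow> bool) \<Rightarrow> nat \<Rightarrow> nat \<Rightarrow> nat \<Rightarrow> nat" where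
  "nwalks n E k x y = card (walks n E k x y)"

definition wstar :: "nat \<Rightarrow> (nat \<Rightarrow> nat \<Rightarrow> bool) \<Rightarrow> nat \<Rightarrow> nat \<Rightarrow> nat list" where
  "wstar n E x y = map (\<lambda>k. nwalks n E k x y) [0..<n]"

datatype wcol = W0 "nat list" | WS wcol "(nat list \<times> wcol) multiset"

fun omega :: "nat \<Rightarrow> (nat \<Rightarrow> nat \<Rightarrow> bool) \<Rightarrow> nat \<Rightarrow> nat \<Rightarrow> wcol" where
  "omega n E 0 x = W0 (wstar n E x x)"
| "omega n E (Suc r) x =
     WS (omega n E r x) (image_mset (\<lambda>y. (wstar n E x y, omega n E r y)) (mset_set {1..n}))"

definition omega_multiset :: "nat \<Rightarrow> (nat \<Rightarrow> nat \<Rightarrow> bool) \<Rightarrow> nat \<Rightarrow> wcol multiset" where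
  "omega_multiset n E r = image_mset (omega n E r) (mset_set {1..n})"

datatype ccol = C0 | CS ccol "ccol multiset"

fun cr :: "nat \<Rightarrow> (nat \<Rightarrow> nat \<Rightarrow> bool) \<Rightarrow> nat \<Rightarrow> nat \<Rightarrow> ccol" where
  "cr n E 0 x = C0"
| "cr n E (Suc r) x =
     CS (cr n E r x) (image_mset (cr n E r) (mset_set {y \<in> {1..n}. E x y}))"

definition WL1 :: "nat \<Rightarrow> (nat \<Rightarrow> nat \<Rightarrow> bool) \<Rightarrow> ccol multiset" where
  "WL1 n E = image_mset (cr n E n) (mset_set {1..n})"

end

theory Submission
  imports Defs
begin

text \<open>
  The graphs are the untwisted and the twisted Cai--Fuerer--Immerman graph over a caterpillar with
  six spine vertices. The twist can sit at any spine vertex \<open>t\<close>: all positions give isomorphic graphs,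
  and the isomorphism between neighbouring positions \<open>t\<close> and \<open>t + 1\<close> moves only the gadgets of these
  two vertices. Twisting at \<open>t\<close> is, up to relabelling the gadget of \<open>t\<close>, a Godsil--McKay switching
  with respect to that gadget, so it preserves all walk counts between vertices outside the gadget.
  Hence the colours \<open>\<omega>\<^sub>r\<close> can only notice the twist if it is cornered: whenever a round of \<open>\<omega>\<close> visits
  a vertex in the gadget of the twist, the twist is moved one step away from the vertices
  visited before. With six spine vertices there is enough room for two rounds. Colour
  refinement, on the other hand, propagates the bits of the gadgets from both ends of the spine
  to the middle and sees whether they match.
\<close>

section \<open>Walk counts and colours over an arbitrary vertex type\<close>

fun walk_count :: "'a set \<Rightarrow> ('a \<Rightarrow> 'a \<Rightarrow> bool) \<Rightarrow> nat \<Rightarrow> 'a \<Rightarrow> 'a \<Rightarrow> nat" where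
  "walk_count V A 0 x y = of_bool (x = y)"
| "walk_count V A (Suc k) x y = (\<Sum>z\<in>{z \<in> V. A x z}. walk_count V A k z y)"

definition walk_vec :: "'a set \<Rightarrow> ('a \<Rightarrow> 'a \<Rightarrow> bool) \<Rightarrow> 'a \<Rightarrow> 'a \<Rightarrow> nat list" where
  "walk_vec V A x y = map (\<lambda>k. walk_count V A k x y) [0..<card V]"

fun walk_col :: "'a set \<Rightarrow> ('a \<Rightarrow> 'a \<Rightarrow> bool) \<Rightarrow> nat \<Rightarrow> 'a \<Rightarrow> wcol" where
  "walk_col V A 0 x = W0 (walk_vec V A x x)"
| "walk_col V A (Suc r) x =
     WS (walk_col V A r x) (image_mset (\<lambda>y. (walk_vec V A x y, walk_col V A r y)) (mset_set V))"

fun refine_col :: "'a set \<Rightarrow> ('a \<Rightarrow> 'a \<Rightarrow> bool) \<Rightarrow> nat \<Rightarrow> 'a \<Rightarrow> ccol" where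
  "refine_col V A 0 x = C0"
| "refine_col V A (Suc r) x =
     CS (refine_col V A r x) (image_mset (refine_col V A r) (mset_set {y \<in> V. A x y}))"

lemma walks_0: "x \<in> {1..n} \<Longrightarrow> walks n E 0 x y = (if x = y then {[x]} else {})"
  by (auto simp: walks_def length_Suc_conv)

lemma walks_Suc:
  assumes "x \<in> {1..n}"
  shows "walks n E (Suc k) x y = (\<Union>z\<in>{z \<in> {1..n}. E x z}. (#) x ` walks n E k z y)"
proof (intro set_eqI iffI)
  fix vs assume "vs \<in> walks n E (Suc k) x y"
  then obtain z ws where vs: "vs = x # z # ws" and len: "length ws = k"
    and sub: "set (z # ws) \<subseteq> {1..n}" and l: "last (z # ws) = y"
    and e: "\<forall>i<Suc k. E (vs ! i) (vs ! Suc i)"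
    by (auto simp: walks_def length_Suc_conv)
  have "z # ws \<in> walks n E k z y"
    using len sub l e by (auto simp: walks_def vs)
  moreover have "E x z" using e vs by fastforce
  ultimately show "vs \<in> (\<Union>z\<in>{z \<in> {1..n}. E x z}. (#) x ` walks n E k z y)"
    using sub vs by auto
next
  fix vs assume "vs \<in> (\<Union>z\<in>{z \<in> {1..n}. E x z}. (#) x ` walks n E k z y)"
  then obtain z ws where "E x z" and vs: "vs = x # ws" and ws: "ws \<in> walks n E k z y" by auto
  have "E (vs ! i) (vs ! Suc i)" if "i < Suc k" for i
    using that ws \<open>E x z\<close> by (cases i; cases ws) (auto simp: vs walks_def)
  then show "vs \<in> walks n E (Suc k) x y"
    using ws assms by (auto simp: vs walks_def)
qed

lemma finite_walks: "finite (walks n E k x y)"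
  by (rule finite_subset[OF _ finite_lists_length_eq[of "{1..n}" "Suc k"]]) (auto simp: walks_def)

lemma nwalks_Suc:
  assumes "x \<in> {1..n}"
  shows "nwalks n E (Suc k) x y = (\<Sum>z\<in>{z \<in> {1..n}. E x z}. nwalks n E k z y)"
proof -
  have "card (walks n E (Suc k) x y)
      = (\<Sum>z\<in>{z \<in> {1..n}. E x z}. card ((#) x ` walks n E k z y))"
    unfolding walks_Suc[OF assms]
    by (rule card_UN_disjoint) (auto simp: finite_walks, auto simp: walks_def)
  then show ?thesis
    by (simp add: nwalks_def card_image)
qed

section \<open>Transport to the vertex set \<open>{1..n}\<close>\<close>

text \<open>The guards are there because \<open>h\<close> is arbitrary outside
  \<open>{1..n}\<close>, where \<open>is_graph\<close> admits no edges.\<close>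

definition pullback :: "nat \<Rightarrow> (nat \<Rightarrow> 'a) \<Rightarrow> ('a \<Rightarrow> 'a \<Rightarrow> bool) \<Rightarrow> nat \<Rightarrow> nat \<Rightarrow> bool" where
  "pullback n h A x y \<longleftrightarrow> x \<in> {1..n} \<and> y \<in> {1..n} \<and> A (h x) (h y)"

context
  fixes n :: nat and h :: "nat \<Rightarrow> 'a" and V :: "'a set" and A :: "'a \<Rightarrow> 'a \<Rightarrow> bool"
  assumes h: "bij_betw h {1..n} V"
begin

lemma bij_betw_neighbours:
  assumes "x \<in> {1..n}"
  shows "bij_betw h {y \<in> {1..n}. pullback n h A x y} {v \<in> V. A (h x) v}"
proof -
  have "h ` {y \<in> {1..n}. pullback n h A x y} = {v \<in> h ` {1..n}. A (h x) v}"
    using assms by (auto simp: pullback_def)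
  then show ?thesis
    using h by (auto simp: bij_betw_def intro: inj_on_subset)
qed

lemma nwalks_pullback:
  "x \<in> {1..n} \<Longrightarrow> y \<in> {1..n} \<Longrightarrow> nwalks n (pullback n h A) k x y = walk_count V A k (h x) (h y)"
proof (induction k arbitrary: x)
  case 0
  then show ?case using inj_on_eq_iff[OF bij_betw_imp_inj_on[OF h]] by (simp add: nwalks_def walks_0)
next
  case (Suc k)
  have "nwalks n (pullback n h A) (Suc k) x y
      = (\<Sum>z\<in>{z \<in> {1..n}. pullback n h A x z}. walk_count V A k (h z) (h y))"
    using Suc by (simp add: nwalks_Suc)
  also have "\<dots> = walk_count V A (Suc k) (h x) (h y)"
    using sum.reindex_bij_betw[OF bij_betw_neighbours[OF Suc.prems(1)], of "\<lambda>v. walk_count V A k v (h y)"]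
    by simp
  finally show ?case .
qed

lemma card_vertices: "card V = n"
  using bij_betw_same_card[OF h] by simp

lemma wstar_pullback:
  "x \<in> {1..n} \<Longrightarrow> y \<in> {1..n} \<Longrightarrow> wstar n (pullback n h A) x y = walk_vec V A (h x) (h y)"
  by (simp add: wstar_def walk_vec_def nwalks_pullback card_vertices)

lemma image_mset_vertices: "image_mset (\<lambda>y. f (h y)) (mset_set {1..n}) = image_mset f (mset_set V)"
proof -
  have "image_mset h (mset_set {1..n}) = mset_set V"
    using h by (simp add: image_mset_mset_set bij_betw_def)
  then show ?thesis
    using multiset.map_comp[of f h "mset_set {1..n}"] by (simp add: comp_def)
qed

lemma omega_pullback:
  "x \<in> {1..n} \<Longrightarrow> omega n (pullback n h A) r x = walk_col V A r (h x)"
proof (induction r arbitrary: x)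
  case (Suc r)
  have "image_mset (\<lambda>y. (wstar n (pullback n h A) x y, omega n (pullback n h A) r y)) (mset_set {1..n})
      = image_mset (\<lambda>y. (walk_vec V A (h x) (h y), walk_col V A r (h y))) (mset_set {1..n})"
    using Suc by (intro image_mset_cong) (auto simp: wstar_pullback)
  also have "\<dots> = image_mset (\<lambda>v. (walk_vec V A (h x) v, walk_col V A r v)) (mset_set V)"
    by (rule image_mset_vertices)
  finally show ?case using Suc by simp
qed (simp add: wstar_pullback)

lemma omega_multiset_pullback:
  "omega_multiset n (pullback n h A) r = image_mset (walk_col V A r) (mset_set V)"
  unfolding omega_multiset_def image_mset_vertices[symmetric]
  by (intro image_mset_cong) (auto simp: omega_pullback)

lemma cr_pullback:
  "x \<in> {1..n} \<Longrightarrow> cr n (pullback n h A) r x = refine_col V A r (h x)"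
proof (induction r arbitrary: x)
  case (Suc r)
  let ?N = "{y \<in> {1..n}. pullback n h A x y}"
  have "image_mset (cr n (pullback n h A) r) (mset_set ?N)
      = image_mset (\<lambda>y. refine_col V A r (h y)) (mset_set ?N)"
    using Suc by (intro image_mset_cong) auto
  also have "\<dots> = image_mset (refine_col V A r) (image_mset h (mset_set ?N))"
    by (simp add: multiset.map_comp comp_def)
  also have "image_mset h (mset_set ?N) = mset_set {v \<in> V. A (h x) v}"
    using bij_betw_neighbours[OF Suc.prems] by (simp add: image_mset_mset_set bij_betw_def)
  finally show ?case using Suc by simp
qed simp

text \<open>Sets of colours are enough: the graphs will be separated by a colour that occurs in only
  one of them.\<close>

lemma set_WL1_pullback: "set_mset (WL1 n (pullback n h A)) = refine_col V A n ` V"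
proof -
  have "cr n (pullback n h A) n ` {1..n} = (\<lambda>x. refine_col V A n (h x)) ` {1..n}"
    by (intro image_cong) (auto simp: cr_pullback)
  also have "\<dots> = refine_col V A n ` V"
    using h by (auto simp: bij_betw_def)
  finally show ?thesis by (simp add: WL1_def)
qed

lemma is_graph_pullback:
  assumes "symp A" "irreflp A"
  shows "is_graph n (pullback n h A)"
  using assms by (auto simp: is_graph_def pullback_def irreflp_def dest: sympD)

end

section \<open>Invariance under isomorphism and comparison of colours\<close>

lemma walk_count_iso:
  assumes f: "bij_betw f V V" and iso: "\<And>x y. x \<in> V \<Longrightarrow> y \<in> V \<Longrightarrow> B (f x) (f y) = A x y"
    and "x \<in> V" "y \<in> V"
  shows "walk_count V B k (f x) (f y) = walk_count V A k x y"
  using \<open>x \<in> V\<close>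
proof (induction k arbitrary: x)
  case 0
  then show ?case using inj_on_eq_iff[OF bij_betw_imp_inj_on[OF f]] \<open>y \<in> V\<close> by simp
next
  case (Suc k)
  have "f ` {z \<in> V. A x z} = {z \<in> f ` V. B (f x) z}"
    using Suc.prems iso by auto
  then have "bij_betw f {z \<in> V. A x z} {z \<in> V. B (f x) z}"
    using f by (auto simp: bij_betw_def intro: inj_on_subset)
  from sum.reindex_bij_betw[OF this, of "\<lambda>z. walk_count V B k z (f y)"]
  show ?case using Suc by simp
qed

lemma walk_vec_iso:
  assumes "bij_betw f V V" "\<And>x y. x \<in> V \<Longrightarrow> y \<in> V \<Longrightarrow> B (f x) (f y) = A x y" "x \<in> V" "y \<in> V"
  shows "walk_vec V B (f x) (f y) = walk_vec V A x y"
  using walk_count_iso[of f V B A, OF assms] by (simp add: walk_vec_def)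

lemma image_mset_eq_bij:
  assumes "bij_betw b V V" "\<And>y. y \<in> V \<Longrightarrow> g (b y) = f y"
  shows "image_mset f (mset_set V) = image_mset g (mset_set V)"
proof (cases "finite V")
  case True
  have "image_mset g (mset_set V) = image_mset g (image_mset b (mset_set V))"
    using assms(1) by (simp add: image_mset_mset_set bij_betw_def)
  also have "\<dots> = image_mset f (mset_set V)"
    using True assms(2) by (auto simp: multiset.map_comp comp_def intro!: image_mset_cong)
  finally show ?thesis ..
qed simp

text \<open>One round of a bijection game: \<open>b\<close> may be chosen depending on
  \<open>x\<close> and \<open>x'\<close> and need not be an isomorphism.\<close>

lemma walk_col_Suc_eq:
  assumes "walk_col V A r x = walk_col V B r x'"
    and "bij_betw b V V"
    and "\<And>y. y \<in> V \<Longrightarrow> walk_vec V B x' (b y) = walk_vec V A x y"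
    and "\<And>y. y \<in> V \<Longrightarrow> walk_col V B r (b y) = walk_col V A r y"
  shows "walk_col V A (Suc r) x = walk_col V B (Suc r) x'"
  using assms by (auto intro!: image_mset_eq_bij[of b])

lemma walk_col_iso:
  assumes f: "bij_betw f V V" and iso: "\<And>x y. x \<in> V \<Longrightarrow> y \<in> V \<Longrightarrow> B (f x) (f y) = A x y"
    and "x \<in> V"
  shows "walk_col V B r (f x) = walk_col V A r x"
  using \<open>x \<in> V\<close>
proof (induction r arbitrary: x)
  case 0
  then show ?case using walk_vec_iso[of f V B A, OF f iso] by simp
next
  case (Suc r)
  then show ?case
    using walk_vec_iso[of f V B A, OF f iso] f
    by (intro walk_col_Suc_eq[symmetric, where b = f]) auto
qed

section \<open>Godsil-McKay switching\<close>

text \<open>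
  Godsil--McKay switching with respect to an independent set \<open>C\<close>, followed by the relabelling \<open>p\<close>.
  The conjugating matrix maps the vector \<open>a\<close> of walk counts to \<open>y\<close> to the vector \<open>b\<close> that agrees with
  \<open>a\<close> outside \<open>C\<close> and has \<open>m * b z = sum a C - m * a (p z)\<close> for \<open>z\<close> in \<open>C\<close>.
\<close>

lemma walk_count_switching:
  fixes A B :: "'a \<Rightarrow> 'a \<Rightarrow> bool"
  assumes fin: "finite V" and CV: "C \<subseteq> V" and cardC: "card C = 2 * m" and m: "m > 0"
    and p: "\<And>c. c \<in> C \<Longrightarrow> p c \<in> C" "\<And>c. c \<in> C \<Longrightarrow> p (p c) = c"
    and symA: "symp A" and symB: "symp B"
    and indep: "\<And>c d. c \<in> C \<Longrightarrow> d \<in> C \<Longrightarrow> \<not> A c d \<and> \<not> B c d"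
    and same: "\<And>x y. x \<in> V - C \<Longrightarrow> y \<in> V - C \<Longrightarrow> B x y = A x y"
    and switch: "\<And>x. x \<in> V - C \<Longrightarrow> (\<forall>c\<in>C. \<not> A x c \<and> \<not> B x c) \<or>
          card {c \<in> C. A x c} = m \<and> (\<forall>c\<in>C. B x c \<longleftrightarrow> \<not> A x (p c))"
    and x: "x \<in> V - C" and y: "y \<in> V - C"
  shows "walk_count V B k x y = walk_count V A k x y"
proof -
  define a where "a k z = int (walk_count V A k z y)" for k z
  define b where "b k z = int (walk_count V B k z y)" for k z
  have finC: "finite C" using CV fin finite_subset by blast
  have bijp: "bij_betw p C C"
    by (rule bij_betw_byWitness[where f' = p]) (use p in auto)
  have aS: "a (Suc k) z = (\<Sum>w\<in>V. of_bool (A z w) * a k w)" for k z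
    unfolding a_def walk_count.simps of_nat_sum using fin by (intro sum.mono_neutral_cong_left) auto
  have bS: "b (Suc k) z = (\<Sum>w\<in>V. of_bool (B z w) * b k w)" for k z
    unfolding b_def walk_count.simps of_nat_sum using fin by (intro sum.mono_neutral_cong_left) auto
  have split: "(\<Sum>w\<in>V. g w) = (\<Sum>w\<in>V - C. g w) + (\<Sum>w\<in>C. g w)" for g :: "'a \<Rightarrow> int"
    using sum.subset_diff[OF CV fin] .
  have count: "(\<Sum>c\<in>C. of_bool (A z c)) = (int m)" if "card {c \<in> C. A z c} = m" for z
    using that finC by (simp add: Int_def)
  have "(\<forall>z\<in>V - C. b k z = a k z) \<and>
      (\<forall>z\<in>C. int m * b k z + int m * a k (p z) = (\<Sum>c\<in>C. a k c))" for k
  proof (induction k)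
    case 0
    \<comment> \<open>As \<open>y\<close> lies outside \<open>C\<close>, both vectors vanish on
      \<open>C\<close> at length 0.\<close>
    then show ?case using y p(1) by (auto simp: a_def b_def intro!: sum.neutral)
  next
    case (Suc k)
    then have IH1: "\<And>z. z \<in> V - C \<Longrightarrow> b k z = a k z"
      and IH2: "\<And>z. z \<in> C \<Longrightarrow> int m * b k z + int m * a k (p z) = (\<Sum>c\<in>C. a k c)"
      by auto
    define S where "S = (\<Sum>c\<in>C. a k c)"
    have out: "b (Suc k) z = a (Suc k) z" if z: "z \<in> V - C" for z
    proof -
      have "(\<Sum>w\<in>C. of_bool (B z w) * b k w) = (\<Sum>w\<in>C. of_bool (A z w) * a k w)"
        using switch[OF z]
      proof (elim disjE conjE)
        assume "card {c \<in> C. A z c} = m" and sw: "\<forall>c\<in>C. B z c = (\<not> A z (p c))"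
        note cnt = count[OF this(1)]
        have "int m * (\<Sum>w\<in>C. of_bool (B z w) * b k w)
            = (\<Sum>w\<in>C. of_bool (\<not> A z (p w)) * (S - int m * a k (p w)))"
          unfolding sum_distrib_left
        proof (rule sum.cong[OF refl])
          fix w assume "w \<in> C"
          then show "int m * (of_bool (B z w) * b k w)
              = of_bool (\<not> A z (p w)) * (S - int m * a k (p w))"
            using IH2[of w] sw by (auto simp: S_def algebra_simps)
        qed
        also have "\<dots> = (\<Sum>w\<in>C. of_bool (\<not> A z w) * (S - int m * a k w))"
          using sum.reindex_bij_betw[OF bijp, of "\<lambda>w. of_bool (\<not> A z w) * (S - int m * a k w)"] .
        also have "\<dots> = (\<Sum>w\<in>C. (S - int m * a k w) - of_bool (A z w) * S
            + int m * (of_bool (A z w) * a k w))"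
          by (rule sum.cong) (auto simp: of_bool_def)
        also have "\<dots> = (int (card C) * S - int m * (\<Sum>w\<in>C. a k w)) - (\<Sum>w\<in>C. of_bool (A z w)) * S
            + int m * (\<Sum>w\<in>C. of_bool (A z w) * a k w)"
          by (simp only: sum.distrib sum_subtractf sum_constant
              flip: sum_distrib_left sum_distrib_right)
        \<comment> \<open>The terms in \<open>S\<close> cancel: \<open>2 * m * S\<close> from
          \<open>card C\<close>, minus \<open>m * S\<close> because \<open>a k\<close> sums to
          \<open>S\<close> over \<open>C\<close>, minus \<open>m * S\<close> because
          \<open>z\<close> has \<open>m\<close> neighbours in \<open>C\<close>.\<close>
        also have "\<dots> = int m * (\<Sum>w\<in>C. of_bool (A z w) * a k w)"
          by (simp only: cnt) (simp add: cardC algebra_simps flip: S_def)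
        finally show ?thesis using m by simp
      qed auto
      moreover have "(\<Sum>w\<in>V - C. of_bool (B z w) * b k w) = (\<Sum>w\<in>V - C. of_bool (A z w) * a k w)"
        using z by (intro sum.cong) (auto simp: IH1 same)
      ultimately show ?thesis by (simp add: aS bS split)
    qed
    have ins: "int m * b (Suc k) z + int m * a (Suc k) (p z) = (\<Sum>c\<in>C. a (Suc k) c)"
      if z: "z \<in> C" for z
    proof -
      have a_out: "a (Suc k) c = (\<Sum>w\<in>V - C. of_bool (A c w) * a k w)" if "c \<in> C" for c
        unfolding aS split using that indep by simp
      have b_out: "b (Suc k) z = (\<Sum>w\<in>V - C. of_bool (B z w) * a k w)"
        unfolding bS split using z indep by (simp add: IH1)
      have "int m * b (Suc k) z + int m * a (Suc k) (p z)
          = (\<Sum>w\<in>V - C. int m * (of_bool (B z w) + of_bool (A (p z) w)) * a k w)"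
        using p(1)[OF z]
        by (simp only: a_out b_out sum_distrib_left distrib_left distrib_right mult.assoc flip: sum.distrib)
      \<comment> \<open>If \<open>w\<close> is joined to \<open>C\<close>, exactly one of
        \<open>B w z\<close> and \<open>A w (p z)\<close> holds, so the coefficient is
        \<open>m\<close>, the number of \<open>A\<close>-neighbours of \<open>w\<close> in
        \<open>C\<close>; otherwise both sides vanish.\<close>
      also have "\<dots> = (\<Sum>w\<in>V - C. (\<Sum>c\<in>C. of_bool (A c w)) * a k w)"
      proof (rule sum.cong[OF refl])
        fix w assume w: "w \<in> V - C"
        have sym: "A c w = A w c" "B c w = B w c" for c
          using symA symB by (metis sympD)+
        have sum_sym: "(\<Sum>c\<in>C. of_bool (A c w)) = (\<Sum>c\<in>C. of_bool (A w c) :: int)"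
          by (rule sum.cong[OF refl]) (rule arg_cong[OF sym(1)])
        have "int m * (of_bool (B w z) + of_bool (A w (p z))) = (\<Sum>c\<in>C. of_bool (A w c))"
          using switch[OF w]
        proof (elim disjE conjE)
          assume "\<forall>c\<in>C. \<not> A w c \<and> \<not> B w c"
          then show ?thesis using z p(1)[OF z] by simp
        next
          assume "card {c \<in> C. A w c} = m" "\<forall>c\<in>C. B w c = (\<not> A w (p c))"
          then show ?thesis using z count[of w] by simp
        qed
        then show "int m * (of_bool (B z w) + of_bool (A (p z) w)) * a k w
            = (\<Sum>c\<in>C. of_bool (A c w)) * a k w"
          by (simp only: sum_sym sym(2)[of z] sym(1)[of "p z"])
      qed
      also have "\<dots> = (\<Sum>c\<in>C. \<Sum>w\<in>V - C. of_bool (A c w) * a k w)"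
        by (subst sum.swap) (simp only: sum_distrib_right)
      also have "\<dots> = (\<Sum>c\<in>C. a (Suc k) c)"
        by (simp add: a_out)
      finally show ?thesis .
    qed
    show ?case using out ins by blast
  qed
  then show ?thesis using x by (simp add: a_def b_def)
qed


section \<open>The twisted graphs\<close>

text \<open>
  \<open>Spine v a b\<close> is the gadget vertex of the spine vertex \<open>v\<close> whose bits at the left and right spine edge
  (or end edge) are \<open>a\<close> and \<open>b\<close>; \<open>True\<close> stands for the bit 0, and the bit at the edge to the leaf is
  determined by parity. The graph \<open>adj t\<close> is twisted at \<open>t\<close>; since the spine is \<open>0, \<dots>, 5\<close>, \<open>adj 6\<close> is
  the untwisted graph.
\<close>

datatype node = Spine nat bool bool | Leaf nat | LeftEnd | RightEnd

fun arc :: "nat \<Rightarrow> node \<Rightarrow> node \<Rightarrow> bool" where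
  "arc t (Spine v a b) (Spine w c d) \<longleftrightarrow> w = Suc v \<and> b = c"
| "arc t (Spine v a b) (Leaf w) \<longleftrightarrow> w = v \<and> (a = b) = (v \<noteq> t)"
| "arc t (Spine v a b) LeftEnd \<longleftrightarrow> v = 0 \<and> a"
| "arc t (Spine v a b) RightEnd \<longleftrightarrow> v = 5 \<and> b"
| "arc t _ _ \<longleftrightarrow> False"

definition adj :: "nat \<Rightarrow> node \<Rightarrow> node \<Rightarrow> bool" where
  "adj t x y \<longleftrightarrow> arc t x y \<or> arc t y x"

definition block :: "nat \<Rightarrow> node set" where
  "block v = {Spine v True True, Spine v True False, Spine v False True, Spine v False False}"

text \<open>An explicit list lets \<open>code_simp\<close> decide statements that quantify over all
  vertices.\<close>

definition node_list :: "node list" where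
  "node_list = [Spine v a b. v \<leftarrow> [0..<6], a \<leftarrow> [True, False], b \<leftarrow> [True, False]]
     @ map Leaf [0..<6] @ [LeftEnd, RightEnd]"

definition nodes :: "node set" where
  "nodes = set node_list"

fun antipode :: "node \<Rightarrow> node" where
  "antipode (Spine v a b) = Spine v (\<not> a) (\<not> b)"
| "antipode x = x"

fun flip :: "nat \<Rightarrow> node \<Rightarrow> node" where
  "flip t (Spine v a b) = Spine v (if v = Suc t then \<not> a else a) (if v = t then \<not> b else b)"
| "flip t x = x"

lemma finite_nodes: "finite nodes"
  by (simp add: nodes_def)

lemma mem_block: "x \<in> block v \<longleftrightarrow> (\<exists>a b. x = Spine v a b)"
  by (cases x) (auto simp: block_def)

lemma mem_nodes:
  "Spine v a b \<in> nodes \<longleftrightarrow> v < 6" "Leaf v \<in> nodes \<longleftrightarrow> v < 6" "LeftEnd \<in> nodes" "RightEnd \<in> nodes"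
  by (auto simp: nodes_def node_list_def)

lemma block_subset_nodes: "t < 6 \<Longrightarrow> block t \<subseteq> nodes"
  by (auto simp: mem_block mem_nodes)

lemma symp_adj: "symp (adj t)"
  by (auto simp: symp_def adj_def)

lemma irreflp_adj: "irreflp (adj t)"
proof -
  have "\<not> arc t x x" for x by (cases x) auto
  then show ?thesis by (simp add: irreflp_def adj_def)
qed

lemma card_block_filter:
  "card {c \<in> block t. P c} = of_bool (P (Spine t True True)) + of_bool (P (Spine t True False))
     + of_bool (P (Spine t False True)) + of_bool (P (Spine t False False))"
proof -
  have "card {c \<in> block t. P c} = (\<Sum>c\<in>block t. of_bool (P c))"
    by (simp add: block_def Int_def)
  then show ?thesis by (simp add: block_def del: sum_of_bool_eq)
qed

text \<open>An outside vertex joined to the gadget sees the half with one spine or end bit fixed or,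
  if it is the leaf, the half of one parity. \<open>antipode\<close> exchanges the halves of the
  first kind and preserves parity, so complementing and relabelling changes only the edges to the
  leaf.\<close>

lemma adj_switching:
  assumes "t < 6" "x \<notin> block t"
  shows "(\<forall>c\<in>block t. \<not> adj 6 x c \<and> \<not> adj t x c) \<or>
    card {c \<in> block t. adj 6 x c} = 2 \<and> (\<forall>c\<in>block t. adj t x c \<longleftrightarrow> \<not> adj 6 x (antipode c))"
proof (cases x)
  case (Spine v a b)
  then have "v \<noteq> t" using assms by (simp add: mem_block)
  then consider "v = Suc t" | "t = Suc v" | "v \<noteq> t" "v \<noteq> Suc t" "t \<noteq> Suc v" by blast
  then show ?thesis
    by cases (simp_all add: Spine card_block_filter adj_def, simp_all add: block_def)
next
  case (Leaf v)
  show ?thesis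
    using assms by (cases "v = t") (simp_all add: Leaf card_block_filter adj_def, simp_all add: block_def)
qed (simp_all add: card_block_filter adj_def, simp_all add: block_def)

lemma walk_vec_twist:
  assumes "t < 6" "x \<in> nodes - block t" "y \<in> nodes - block t"
  shows "walk_vec nodes (adj t) x y = walk_vec nodes (adj 6) x y"
proof -
  have "walk_count nodes (adj t) k x y = walk_count nodes (adj 6) k x y" for k
  proof (rule walk_count_switching[where C = "block t" and m = 2 and p = antipode])
    show "block t \<subseteq> nodes" using assms(1) by (rule block_subset_nodes)
    show "card (block t) = 2 * 2" by (simp add: block_def)
    \<comment> \<open>Membership in \<open>nodes\<close> matters: it excludes position 6, where
      \<open>adj 6\<close> does have its twist.\<close>
    show "adj t x y = adj 6 x y" if "x \<in> nodes - block t" "y \<in> nodes - block t" for x y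
      using that by (cases x; cases y) (auto simp: adj_def mem_block mem_nodes)
  qed (use assms adj_switching symp_adj finite_nodes in \<open>auto simp: mem_block adj_def\<close>)
  then show ?thesis by (simp add: walk_vec_def)
qed

section \<open>Moving the twist along the spine\<close>

lemma flip_flip: "flip t (flip t x) = x"
  by (cases x) auto

lemma flip_mem: "flip t x \<in> block v \<longleftrightarrow> x \<in> block v" "flip t x \<in> nodes \<longleftrightarrow> x \<in> nodes"
  by (cases x; auto simp: mem_block mem_nodes)+

lemma flip_fixed: "x \<notin> block t \<Longrightarrow> x \<notin> block (Suc t) \<Longrightarrow> flip t x = x"
  by (cases x) (auto simp: mem_block)

lemma bij_betw_flip: "bij_betw (flip t) nodes nodes"
  by (rule bij_betw_byWitness[where f' = "flip t"]) (auto simp: flip_flip flip_mem)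

text \<open>Both copies of the bit at the spine edge from \<open>t\<close> to \<open>Suc t\<close>
  are inverted. Adjacency along this edge survives, while the parity towards both leaves changes,
  which moves the twist. For \<open>t = 5\<close> the edges to \<open>RightEnd\<close> would
  break.\<close>

lemma adj_flip: "t < 5 \<Longrightarrow> adj (Suc t) (flip t x) (flip t y) = adj t x y"
  by (cases x; cases y) (auto simp: adj_def)

definition neighbour_twist :: "nat \<Rightarrow> nat \<Rightarrow> bool" where
  "neighbour_twist t s \<longleftrightarrow> t < 6 \<and> s < 6 \<and> (s = Suc t \<or> t = Suc s)"

lemma adj_flip_min:
  assumes "neighbour_twist t s"
  shows "adj s (flip (min t s) x) (flip (min t s) y) = adj t x y"
proof (cases "s = Suc t")
  case True
  then show ?thesis using assms adj_flip by (simp add: neighbour_twist_def)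
next
  case False
  then have "t = Suc s" "s < 5" using assms by (auto simp: neighbour_twist_def)
  then show ?thesis using adj_flip[of s "flip s x" "flip s y"] by (simp add: flip_flip)
qed

lemma flip_min_fixed:
  assumes "neighbour_twist t s" "x \<notin> block t" "x \<notin> block s"
  shows "flip (min t s) x = x"
  using assms by (intro flip_fixed) (auto simp: neighbour_twist_def)

text \<open>A vertex \<open>y\<close> outside the gadget of \<open>t\<close> is matched with itself.
  For \<open>y\<close> inside, the isomorphism \<open>f\<close>, which fixes \<open>x\<close>, moves
  the twist to \<open>s\<close>, and then both \<open>x\<close> and \<open>y\<close> lie outside the
  gadget of the twist. So \<open>b\<close> applies \<open>f\<close> only inside the gadget of
  \<open>t\<close>.\<close>

lemma walk_col_Suc_twist:
  assumes ts: "neighbour_twist t s"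
    and x: "x \<in> nodes - block t - block s"
    and col_x: "walk_col nodes (adj 6) r x = walk_col nodes (adj t) r x"
    and col_out: "\<And>y. y \<in> nodes - block t \<Longrightarrow> walk_col nodes (adj 6) r y = walk_col nodes (adj t) r y"
    and col_in: "\<And>y. y \<in> block t \<Longrightarrow> walk_col nodes (adj 6) r y = walk_col nodes (adj s) r y"
  shows "walk_col nodes (adj 6) (Suc r) x = walk_col nodes (adj t) (Suc r) x"
proof -
  define f where "f = flip (min t s)"
  note f = bij_betw_flip[of "min t s", folded f_def] adj_flip_min[OF ts, folded f_def]
    flip_flip[of "min t s", folded f_def] flip_mem[of "min t s", folded f_def]
    flip_min_fixed[OF ts, folded f_def]
  have ts6: "t < 6" "s < 6" and disj: "block t \<inter> block s = {}"
    using ts by (auto simp: neighbour_twist_def mem_block)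
  define b where "b y = (if y \<in> block t then f y else y)" for y
  show ?thesis
  proof (rule walk_col_Suc_eq[where b = b, OF col_x])
    show "bij_betw b nodes nodes"
      by (rule bij_betw_byWitness[where f' = b]) (auto simp: b_def f)
    fix y assume y: "y \<in> nodes"
    have vec: "walk_vec nodes (adj t) x (f y) = walk_vec nodes (adj s) x y"
      using walk_vec_iso[of f nodes "adj s" "adj t" x "f y"] f x y by auto
    show "walk_vec nodes (adj t) x (b y) = walk_vec nodes (adj 6) x y"
    proof (cases "y \<in> block t")
      case True
      then show ?thesis
        using vec walk_vec_twist[OF ts6(2), of x y] x y disj by (auto simp: b_def)
    next
      case False
      then show ?thesis using walk_vec_twist[OF ts6(1), of x y] x y by (auto simp: b_def)
    qed
    have "walk_col nodes (adj t) r (f y) = walk_col nodes (adj s) r y"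
      using walk_col_iso[of f nodes "adj s" "adj t" "f y" r] f y by auto
    then show "walk_col nodes (adj t) r (b y) = walk_col nodes (adj 6) r y"
      using col_out[of y] col_in[of y] y by (auto simp: b_def)
  qed
qed

lemma walk_col_0_twist:
  "t < 6 \<Longrightarrow> x \<in> nodes - block t \<Longrightarrow> walk_col nodes (adj 6) 0 x = walk_col nodes (adj t) 0 x"
  by (simp add: walk_vec_twist)

lemma disjoint_blocks: "t \<noteq> s \<Longrightarrow> block t \<inter> block s = {}"
  by (auto simp: mem_block)

lemma walk_col_1_twist:
  assumes ts: "neighbour_twist t s" and x: "x \<in> nodes - block t - block s"
  shows "walk_col nodes (adj 6) (Suc 0) x = walk_col nodes (adj t) (Suc 0) x"
proof -
  have ts6: "t < 6" "s < 6" "t \<noteq> s" using ts by (auto simp: neighbour_twist_def)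
  show ?thesis
    by (rule walk_col_Suc_twist[OF ts x])
      (use ts6 x block_subset_nodes disjoint_blocks in \<open>blast intro: walk_col_0_twist\<close>)+
qed

text \<open>The positions \<open>q\<close>, \<open>t\<close>, \<open>s\<close>, \<open>u\<close> are
  consecutive. If the first visited vertex lies in the gadget of \<open>s\<close>, the twist at
  \<open>t\<close> can still escape to \<open>q\<close>; if it lies in the gadget of
  \<open>t\<close>, the twist has gone to \<open>s\<close> and can escape to
  \<open>u\<close>.\<close>

lemma walk_col_2_twist:
  assumes ts: "neighbour_twist t s" and tq: "neighbour_twist t q" and su: "neighbour_twist s u"
    and ne: "q \<noteq> s" "u \<noteq> t" and x: "x \<in> nodes - block t - block s"
  shows "walk_col nodes (adj 6) (Suc (Suc 0)) x = walk_col nodes (adj t) (Suc (Suc 0)) x"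
proof (rule walk_col_Suc_twist[OF ts x])
  have ts6: "t < 6" "s < 6" "t \<noteq> s" using ts by (auto simp: neighbour_twist_def)
  show "walk_col nodes (adj 6) (Suc 0) x = walk_col nodes (adj t) (Suc 0) x"
    by (rule walk_col_1_twist[OF ts x])
  show "walk_col nodes (adj 6) (Suc 0) y = walk_col nodes (adj t) (Suc 0) y"
    if y: "y \<in> nodes - block t" for y
  proof (cases "y \<in> block s")
    case True
    then show ?thesis
      using walk_col_1_twist[OF tq, of y] disjoint_blocks[OF ne(1)] y by blast
  next
    case False
    then show ?thesis using walk_col_1_twist[OF ts, of y] y by blast
  qed
  show "walk_col nodes (adj 6) (Suc 0) y = walk_col nodes (adj s) (Suc 0) y"
    if y: "y \<in> block t" for y
    using walk_col_1_twist[OF su, of y] y ts6 disjoint_blocks[OF ne(2)] disjoint_blocks[of t s]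
      block_subset_nodes[of t] by blast
qed

text \<open>Vertices in gadgets 3, 4, 5 are compared with a twist at 2, using the positions 3, 2, 1,
  0; all others with a twist at 3, using 2, 3, 4, 5. \<open>flip 2\<close> carries the first twisted
  graph to the second.\<close>

lemma walk_col_2_multiset:
  "image_mset (walk_col nodes (adj 6) 2) (mset_set nodes)
     = image_mset (walk_col nodes (adj 3) 2) (mset_set nodes)"
proof -
  define b where "b x = (if x \<in> block 3 \<union> block 4 \<union> block 5 then flip 2 x else x)" for x
  have nt: "neighbour_twist 3 4" "neighbour_twist 3 2" "neighbour_twist 4 5"
    "neighbour_twist 2 3" "neighbour_twist 2 1" "neighbour_twist 1 0"
    by (auto simp: neighbour_twist_def)
  have bij: "bij_betw b nodes nodes"
    by (rule bij_betw_byWitness[where f' = b]) (auto simp: b_def flip_flip flip_mem)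
  have two: "2 = Suc (Suc 0)" by simp
  have "walk_col nodes (adj 3) 2 (b x) = walk_col nodes (adj 6) 2 x" if x: "x \<in> nodes" for x
  proof (cases "x \<in> block 3 \<union> block 4 \<union> block 5")
    case True
    then have "x \<in> nodes - block 2 - block 1" using x by (auto simp: mem_block)
    then have "walk_col nodes (adj 6) 2 x = walk_col nodes (adj 2) 2 x"
      using walk_col_2_twist[OF nt(5,4,6)] unfolding two by simp
    moreover have "walk_col nodes (adj 3) 2 (flip 2 x) = walk_col nodes (adj 2) 2 x"
      by (rule walk_col_iso[OF bij_betw_flip _ x]) (use adj_flip[of 2] in simp)
    ultimately show ?thesis using True by (simp add: b_def)
  next
    case False
    then have "walk_col nodes (adj 6) 2 x = walk_col nodes (adj 3) 2 x"
      using walk_col_2_twist[OF nt(1,2,3), of x] x unfolding two by simp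
    then show ?thesis using False by (simp add: b_def)
  qed
  then show ?thesis by (rule image_mset_eq_bij[OF bij])
qed

section \<open>Colour refinement separates the graphs\<close>

text \<open>
  The predicates below follow, on colours of colour refinement, the two chains that start at the two
  ends of the spine and pass through gadget vertices adjacent to their leaf. In the untwisted graph the chains meet in the
  middle, in the twisted graph they do not.
\<close>

fun nbr_cols :: "ccol \<Rightarrow> ccol multiset" where
  "nbr_cols C0 = {#}"
| "nbr_cols (CS c M) = M"

definition end_leaf_col :: "ccol \<Rightarrow> bool" where
  "end_leaf_col c \<longleftrightarrow> size (nbr_cols c) = 2 \<and> (\<exists>d\<in>#nbr_cols c. size (nbr_cols d) = 3)"

definition tip_col :: "ccol \<Rightarrow> bool" where
  "tip_col c \<longleftrightarrow> size (nbr_cols c) = 4 \<and> (\<exists>d\<in>#nbr_cols c. end_leaf_col d)"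

definition second_col :: "ccol \<Rightarrow> bool" where
  "second_col c \<longleftrightarrow> size (nbr_cols c) = 5 \<and> (\<exists>d\<in>#nbr_cols c. tip_col d)"

definition third_col :: "ccol \<Rightarrow> bool" where
  "third_col c \<longleftrightarrow> size (nbr_cols c) = 5 \<and> (\<exists>d\<in>#nbr_cols c. second_col d)"

definition linked_col :: "ccol \<Rightarrow> bool" where
  "linked_col c \<longleftrightarrow> third_col c \<and> (\<exists>d\<in>#nbr_cols c. third_col d)"

definition degree :: "nat \<Rightarrow> node \<Rightarrow> nat" where
  "degree t x = length (filter (adj t x) node_list)"

lemma distinct_node_list: "distinct node_list"
  by code_simp

lemma card_nodes: "card nodes = 32"
proof -
  have "length node_list = 32" by code_simp
  then show ?thesis by (simp add: nodes_def distinct_card distinct_node_list)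
qed

lemma size_nbr_cols: "size (nbr_cols (refine_col nodes (adj t) (Suc r) x)) = degree t x"
proof -
  have "{y \<in> nodes. adj t x y} = set (filter (adj t x) node_list)"
    by (auto simp: nodes_def)
  then have "card {y \<in> nodes. adj t x y} = degree t x"
    by (simp add: degree_def distinct_card distinct_node_list del: set_filter)
  then show ?thesis by simp
qed

lemma ex_nbr_cols:
  "(\<exists>d\<in>#nbr_cols (refine_col nodes (adj t) (Suc r) x). P d)
     \<longleftrightarrow> (\<exists>y\<in>nodes. adj t x y \<and> P (refine_col nodes (adj t) r y))"
  by (auto simp: finite_nodes)

text \<open>Vertices of degree 3 occur only in the end gadgets. Inner leaves see only degree 5, and
  the degree 2 vertices of the end gadgets see only degrees 4 and 5. Each further predicate looks
  one step deeper and costs one more round; \<open>r\<close> stays free so that the spare rounds do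
  no harm.\<close>

lemma end_leaf_col_iff:
  assumes t: "t \<in> set [3, 6]" and "x \<in> nodes"
  shows "end_leaf_col (refine_col nodes (adj t) (Suc (Suc r)) x)
    \<longleftrightarrow> x \<in> set [Leaf 0, Leaf 5, LeftEnd, RightEnd]"
proof -
  have "\<forall>t\<in>set [3, 6]. \<forall>x\<in>nodes.
      (degree t x = 2 \<and> (\<exists>y\<in>nodes. adj t x y \<and> degree t y = 3))
        \<longleftrightarrow> x \<in> set [Leaf 0, Leaf 5, LeftEnd, RightEnd]"
    by code_simp
  with assms show ?thesis
    unfolding end_leaf_col_def size_nbr_cols ex_nbr_cols
    by (simp add: size_nbr_cols del: set_simps refine_col.simps cong: conj_cong bex_cong)
qed

lemma tip_col_iff:
  assumes t: "t \<in> set [3, 6]" and "x \<in> nodes"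
  shows "tip_col (refine_col nodes (adj t) (Suc (Suc (Suc r))) x)
    \<longleftrightarrow> x \<in> set [Spine 0 True True, Spine 5 True True]"
proof -
  have "\<forall>t\<in>set [3, 6]. \<forall>x\<in>nodes.
      (degree t x = 4 \<and> (\<exists>y\<in>nodes. adj t x y \<and> y \<in> set [Leaf 0, Leaf 5, LeftEnd, RightEnd]))
        \<longleftrightarrow> x \<in> set [Spine 0 True True, Spine 5 True True]"
    by code_simp
  with assms show ?thesis
    unfolding tip_col_def size_nbr_cols ex_nbr_cols
    by (simp add: end_leaf_col_iff[OF t] del: set_simps refine_col.simps cong: conj_cong bex_cong)
qed

lemma second_col_iff:
  assumes t: "t \<in> set [3, 6]" and "x \<in> nodes"
  shows "second_col (refine_col nodes (adj t) (Suc (Suc (Suc (Suc r)))) x)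
    \<longleftrightarrow> x \<in> set [Spine 1 True True, Spine 4 True True]"
proof -
  have "\<forall>t\<in>set [3, 6]. \<forall>x\<in>nodes.
      (degree t x = 5 \<and> (\<exists>y\<in>nodes. adj t x y \<and> y \<in> set [Spine 0 True True, Spine 5 True True]))
        \<longleftrightarrow> x \<in> set [Spine 1 True True, Spine 4 True True]"
    by code_simp
  with assms show ?thesis
    unfolding second_col_def size_nbr_cols ex_nbr_cols
    by (simp add: tip_col_iff[OF t] del: set_simps refine_col.simps cong: conj_cong bex_cong)
qed

text \<open>With the twist at 3, a vertex of gadget 3 is joined to its leaf when its bits differ, so
  the chain from the right arrives with the left bit \<open>False\<close> and misses
  \<open>Spine 2 True True\<close>.\<close>

lemma third_col_iff:
  assumes t: "t \<in> set [3, 6]" and "x \<in> nodes"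
  shows "third_col (refine_col nodes (adj t) (Suc (Suc (Suc (Suc (Suc r))))) x)
    \<longleftrightarrow> x \<in> set [Spine 2 True True, Spine 3 (t = 6) True]"
proof -
  have "\<forall>t\<in>set [3, 6]. \<forall>x\<in>nodes.
      (degree t x = 5 \<and> (\<exists>y\<in>nodes. adj t x y \<and> y \<in> set [Spine 1 True True, Spine 4 True True]))
        \<longleftrightarrow> x \<in> set [Spine 2 True True, Spine 3 (t = 6) True]"
    by code_simp
  with assms show ?thesis
    unfolding third_col_def size_nbr_cols ex_nbr_cols
    by (simp add: second_col_iff[OF t] del: set_simps refine_col.simps cong: conj_cong bex_cong)
qed

lemma WL1_twist:
  assumes h: "bij_betw h {1..32} nodes"
  shows "WL1 32 (pullback 32 h (adj 6)) \<noteq> WL1 32 (pullback 32 h (adj 3))"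
proof -
  have linked: "linked_col (refine_col nodes (adj t) 32 x) \<longleftrightarrow>
      x \<in> set [Spine 2 True True, Spine 3 (t = 6) True] \<and>
      (\<exists>y\<in>nodes. adj t x y \<and> y \<in> set [Spine 2 True True, Spine 3 (t = 6) True])"
    if "t \<in> set [3, 6]" "x \<in> nodes" for t x
  proof -
    \<comment> \<open>Six rounds are needed: five for \<open>third_col\<close> at a neighbour and
      one to reach it.\<close>
    have "32 = Suc (Suc (Suc (Suc (Suc (Suc 26)))))" by simp
    then show ?thesis
      unfolding linked_col_def
      by (simp only: ex_nbr_cols third_col_iff[OF that] third_col_iff[OF that(1)] cong: conj_cong bex_cong)
  qed
  have "linked_col (refine_col nodes (adj 6) 32 (Spine 2 True True))"
    by (subst linked) (auto simp: mem_nodes adj_def intro!: bexI[of _ "Spine 3 True True"])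
  moreover have "\<not> linked_col (refine_col nodes (adj 3) 32 x)" if "x \<in> nodes" for x
    using that by (subst linked) (auto simp: adj_def)
  ultimately have "refine_col nodes (adj 6) 32 ` nodes \<noteq> refine_col nodes (adj 3) 32 ` nodes"
    using mem_nodes(1)[of 2 True True] by auto (metis imageE imageI)
  then show ?thesis
    using set_WL1_pullback[OF h, of "adj 6"] set_WL1_pullback[OF h, of "adj 3"] by metis
qed

theorem theorem6p2:
  shows "\<exists>n E m F. is_graph n E \<and> is_graph m F \<and>
           omega_multiset n E 2 = omega_multiset m F 2 \<and> WL1 n E \<noteq> WL1 m F"
proof -
  obtain h :: "nat \<Rightarrow> node" where h: "bij_betw h {1..32} nodes"
    using ex_bij_betw_nat_finite_1[OF finite_nodes] card_nodes by auto
  show ?thesis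
  proof (intro exI conjI)
    show "is_graph 32 (pullback 32 h (adj 6))" "is_graph 32 (pullback 32 h (adj 3))"
      using is_graph_pullback[OF h symp_adj irreflp_adj] by auto
    show "omega_multiset 32 (pullback 32 h (adj 6)) 2 = omega_multiset 32 (pullback 32 h (adj 3)) 2"
      by (simp only: omega_multiset_pullback[OF h] walk_col_2_multiset)
    show "WL1 32 (pullback 32 h (adj 6)) \<noteq> WL1 32 (pullback 32 h (adj 3))"
      by (rule WL1_twist[OF h])
  qed
qed

end
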